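(* Let $\mathcal H$ be a separable Hilbert space, $J$ a countable index set, $I=\{1,\dots,m\}$ with $m\ge2$. For each $i\in I$ let $F_i=\{f_{ij}\}_{j\in J}$ be a frame for $\mathcal H$ with bounds $A_i,B_i$ and synthesis operator $T_{F_i}$. Assume that for any $k\in I$ and any $i\in I$, $$\|T_{F_i}-T_{F_k}\|<\frac{A_k}{(m-1)(\sqrt{B_i}+\sqrt{B_k})}.$$ Then the family of frames $\{F_i\}_{i\in I}$ is woven.
   Context: A sequence $\{f_j\}_{j\in J}$ in $\mathcal H$ is a frame for $\mathcal H$ with lower and upper bounds $A,B>0$ if $A\|f\|^2\le\sum_{j\in J}|\langle f,f_j\rangle|^2\le B\|f\|^2$ for all $f\in\mathcal H$. The synthesis operator of a frame $F=\{f_j\}_{j\in J}$ is $T_F:\ell^2(J)\to\mathcal H$, $T_F(\{c_j\})=\sum_{j\in J}c_jf_j$. A partition $\{\sigma_i\}_{i\in I}$ of $J$ is a family of pairwise disjoint (possibly empty) subsets of $J$ with union $J$. A family of frames $\{F_i=\{f_{ij}\}_{j\in J}\}_{i\in I}$ is woven if there are universal constants $A,B>0$ such that for every partition $\{\sigma_i\}_{i\in I}$ of $J$ the family $\{f_{ij}\}_{j\in\sigma_i,i\in I}$ is a frame for $\mathcal H$ with bounds $A$ and $B$. *)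

theory Defs
  imports "HOL-Analysis.Analysis"
begin

section \<open>Real and complex Hilbert spaces\<close>

text \<open>
  The scalar field is \<^typ>\<open>real\<close> or \<^typ>\<open>complex\<close>; the class treats both at once. Up to
  isomorphism it has no other models: the axioms give \<open>z + conjg z \<in> \<real>\<close> and \<open>z * conjg z \<in> \<real>\<close>, so every
  element is quadratic over the reals.
\<close>

class real_or_complex = real_normed_field +
  fixes conjg :: "'a \<Rightarrow> 'a"
  assumes conjg_add: "conjg (x + y) = conjg x + conjg y"
    and conjg_mult: "conjg (x * y) = conjg x * conjg y"
    and mult_conjg: "x * conjg x = (norm x)\<^sup>2 *\<^sub>R 1"

instantiation real :: real_or_complex
begin
definition conjg_real :: "real \<Rightarrow> real" where "conjg_real x = x"
instance by standard (auto simp: conjg_real_def power2_eq_square)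
end

instantiation complex :: real_or_complex
begin
definition conjg_complex :: "complex \<Rightarrow> complex" where "conjg_complex x = cnj x"
instance
  by standard (auto simp: conjg_complex_def complex_norm_square scaleR_conv_of_real simp del: of_real_power)
end

text \<open>
  The vectors form a type of class \<^class>\<open>banach\<close>, which supplies the norm, the topology and
  completeness; the locale says that the norm comes from the inner product. The inner product is
  linear in its first argument.
\<close>

locale hilbert_space = vector_space smul
  for smul :: "'k::real_or_complex \<Rightarrow> 'h::banach \<Rightarrow> 'h" +
  fixes ip :: "'h \<Rightarrow> 'h \<Rightarrow> 'k"
  assumes smul_of_real: "smul (of_real r) x = r *\<^sub>R x"
    and ip_add_left: "ip (x + y) z = ip x z + ip y z"
    and ip_smul_left: "ip (smul c x) y = c * ip x y"
    and ip_conjg: "ip y x = conjg (ip x y)"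
    and ip_self: "ip x x = of_real ((norm x)\<^sup>2)"

locale separable_hilbert_space = hilbert_space smul ip
  for smul :: "'k::real_or_complex \<Rightarrow> 'h::banach \<Rightarrow> 'h" and ip :: "'h \<Rightarrow> 'h \<Rightarrow> 'k" +
  assumes separable: "separable_space (euclidean :: 'h topology)"

lemma hilbert_space_real_inner:
  "hilbert_space scaleR (inner :: 'h::{real_inner, banach} \<Rightarrow> 'h \<Rightarrow> real)"
  by unfold_locales
    (auto simp: algebra_simps inner_commute conjg_real_def power2_norm_eq_inner)

lemma hilbert_space_complex: "hilbert_space (*) (\<lambda>x y :: complex. x * cnj y)"
  by unfold_locales
    (auto simp: algebra_simps conjg_complex_def complex_norm_square scaleR_conv_of_real
      simp del: of_real_power)

section \<open>Frames\<close>

definition frame_with_bounds ::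
  "('h::banach \<Rightarrow> 'h \<Rightarrow> 'k::real_or_complex) \<Rightarrow> 'j set \<Rightarrow> ('j \<Rightarrow> 'h) \<Rightarrow> real \<Rightarrow> real \<Rightarrow> bool"
  where
  "frame_with_bounds ip J F A B \<longleftrightarrow> A > 0 \<and> B > 0 \<and>
     (\<forall>x. (\<lambda>j. (norm (ip x (F j)))\<^sup>2) summable_on J \<and>
          A * (norm x)\<^sup>2 \<le> (\<Sum>\<^sub>\<infinity>j\<in>J. (norm (ip x (F j)))\<^sup>2) \<and>
          (\<Sum>\<^sub>\<infinity>j\<in>J. (norm (ip x (F j)))\<^sup>2) \<le> B * (norm x)\<^sup>2)"

text \<open>The sequences in \<open>\<ell>\<^sup>2(J)\<close> are functions on the whole type, extended by zero outside \<open>J\<close>.\<close>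

definition ell2 :: "'j set \<Rightarrow> ('j \<Rightarrow> 'k::real_or_complex) set" where
  "ell2 J = {c. (\<forall>j. j \<notin> J \<longrightarrow> c j = 0) \<and> (\<lambda>j. (norm (c j))\<^sup>2) summable_on J}"

definition ell2_norm :: "'j set \<Rightarrow> ('j \<Rightarrow> 'k::real_or_complex) \<Rightarrow> real" where
  "ell2_norm J c = sqrt (\<Sum>\<^sub>\<infinity>j\<in>J. (norm (c j))\<^sup>2)"

definition synthesis ::
  "('k::real_or_complex \<Rightarrow> 'h::banach \<Rightarrow> 'h) \<Rightarrow> 'j set \<Rightarrow> ('j \<Rightarrow> 'h) \<Rightarrow> ('j \<Rightarrow> 'k) \<Rightarrow> 'h"
  where "synthesis smul J F c = (\<Sum>\<^sub>\<infinity>j\<in>J. smul (c j) (F j))"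

text \<open>
  The operator norm of a linear map \<open>\<ell>\<^sup>2(J) \<rightarrow> H\<close>. The supremum is a real number, so it is meaningful
  for bounded maps, in particular for differences of synthesis operators of frames.
\<close>

definition ell2_onorm :: "'j set \<Rightarrow> (('j \<Rightarrow> 'k::real_or_complex) \<Rightarrow> 'h::banach) \<Rightarrow> real" where
  "ell2_onorm J T = (SUP c\<in>{c \<in> ell2 J. ell2_norm J c \<le> 1}. norm (T c))"

section \<open>Woven frames\<close>

text \<open>The parts are indexed and may be empty.\<close>

definition indexed_partition :: "'i set \<Rightarrow> 'j set \<Rightarrow> ('i \<Rightarrow> 'j set) \<Rightarrow> bool" where
  "indexed_partition I J \<sigma> \<longleftrightarrow> disjoint_family_on \<sigma> I \<and> (\<Union>i\<in>I. \<sigma> i) = J"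

definition woven ::
  "('h::banach \<Rightarrow> 'h \<Rightarrow> 'k::real_or_complex) \<Rightarrow> 'i set \<Rightarrow> 'j set \<Rightarrow> ('i \<Rightarrow> 'j \<Rightarrow> 'h) \<Rightarrow> bool"
  where
  "woven ip I J f \<longleftrightarrow> (\<exists>A B. A > 0 \<and> B > 0 \<and>
     (\<forall>\<sigma>. indexed_partition I J \<sigma> \<longrightarrow>
        frame_with_bounds ip (SIGMA i:I. \<sigma> i) (\<lambda>(i, j). f i j) A B))"

end

theory Submission
  imports Defs
begin

text \<open>
  Fix a vector \<open>x\<close> and compare the coefficients of \<open>x\<close> with respect to the family selected by a
  partition with those with respect to \<open>F\<^sub>1\<close>. On the part \<open>\<sigma>\<^sub>i\<close> the two square sums differ by
  at most \<open>\<parallel>T\<^sub>i - T\<^sub>1\<parallel> (\<surd>B\<^sub>i + \<surd>B\<^sub>1) \<parallel>x\<parallel>\<^sup>2\<close>, because \<open>\<parallel>T\<^sub>i\<^sup>* - T\<^sub>1\<^sup>*\<parallel> = \<parallel>T\<^sub>i - T\<^sub>1\<parallel>\<close>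
  and \<open>a\<^sup>2 - b\<^sup>2 = (a - b) (a + b)\<close>. Only the \<open>m - 1\<close> parts with \<open>i \<noteq> 1\<close> contribute, so the total
  loss is strictly below \<open>A\<^sub>1 \<parallel>x\<parallel>\<^sup>2\<close>.
\<close>

section \<open>Conjugation on the scalar field\<close>

lemma conjg_0 [simp]: "conjg (0 :: 'k::real_or_complex) = 0"
  using conjg_add[of 0 "0::'k"] by simp

lemma norm_conjg [simp]: "norm (conjg x) = norm (x :: 'k::real_or_complex)"
proof (cases "x = 0")
  case False
  have "norm x * norm (conjg x) = norm x * norm x"
    using arg_cong[OF mult_conjg[of x], of norm] by (simp add: norm_mult power2_eq_square)
  with False show ?thesis by simp
qed simp

lemma mult_conjg_of_real: "x * conjg x = of_real ((norm x)\<^sup>2)" for x :: "'k::real_or_complex"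
  by (simp add: mult_conjg of_real_def)

text \<open>No axiom says that \<open>conjg\<close> fixes the reals; this comes from cancelling a
  nonzero \<open>r\<close> in \<open>x * conjg x = of_real ((norm x)^2)\<close> at
  \<open>x = of_real r\<close>.\<close>

lemma conjg_of_real [simp]: "conjg (of_real r :: 'k::real_or_complex) = of_real r"
proof (cases "r = 0")
  case False
  have "of_real r * conjg (of_real r :: 'k) = of_real r * of_real r"
    by (simp add: mult_conjg_of_real power2_eq_square)
  with False show ?thesis by simp
qed simp

section \<open>Cauchy-Schwarz, and the duality between synthesis and analysis\<close>

context hilbert_space
begin

lemma ip_add_right: "ip x (y + z) = ip x y + ip x z"
  by (metis ip_add_left ip_conjg conjg_add)

lemma ip_smul_right: "ip x (smul c y) = conjg c * ip x y"
  by (metis ip_smul_left ip_conjg conjg_mult)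

lemma ip_zero_left [simp]: "ip 0 y = 0"
  using ip_add_left[of 0 0 y] by simp

lemma ip_zero_right [simp]: "ip x 0 = 0"
  using ip_add_right[of x 0 0] by simp

lemma ip_diff_left: "ip (x - y) z = ip x z - ip y z"
  using ip_add_left[of "x - y" y z] by simp

lemma ip_diff_right: "ip x (y - z) = ip x y - ip x z"
  using ip_add_right[of x "y - z" z] by simp

lemma ip_sum_right: "ip x (\<Sum>j\<in>F. g j) = (\<Sum>j\<in>F. ip x (g j))"
  by (induction F rule: infinite_finite_induct) (auto simp: ip_add_right)

lemma Cauchy_Schwarz: "norm (ip x y) \<le> norm x * norm y"
proof (cases "y = 0")
  case False
  define s where "s = (norm y)\<^sup>2"
  define a where "a = ip x y"
  \<comment> \<open>This is \<open>s\<close> times the component of \<open>x\<close> orthogonal to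
    \<open>y\<close>; scaling by \<open>s\<close> clears the denominator of the projection
    coefficient \<open>a / s\<close>.\<close>
  define z where "z = smul (of_real s) x - smul a y"
  have s: "s > 0" using False by (simp add: s_def)
  have zy: "ip z y = 0"
    by (simp add: z_def ip_diff_left ip_smul_left ip_self s_def a_def)
  have "ip z z = of_real s * ip z x"
    by (subst (2) z_def) (simp add: ip_diff_right ip_smul_right zy)
  also have "ip z x = of_real s * of_real ((norm x)\<^sup>2) - a * conjg a"
    by (simp add: z_def ip_diff_left ip_smul_left ip_self a_def flip: ip_conjg)
  finally have "of_real ((norm z)\<^sup>2) = (of_real (s * (s * (norm x)\<^sup>2 - (norm a)\<^sup>2)) :: 'k)"
    by (simp add: ip_self mult_conjg_of_real)
  then have "s * (s * (norm x)\<^sup>2 - (norm a)\<^sup>2) = (norm z)\<^sup>2"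
    by (simp only: of_real_eq_iff)
  then have "0 \<le> s * (s * (norm x)\<^sup>2 - (norm a)\<^sup>2)" by simp
  with s have "(norm a)\<^sup>2 \<le> s * (norm x)\<^sup>2"
    by (simp add: zero_le_mult_iff)
  then have "(norm a)\<^sup>2 \<le> (norm x * norm y)\<^sup>2"
    by (simp add: s_def power_mult_distrib mult.commute)
  then show ?thesis
    unfolding a_def by (rule power2_le_imp_le) simp
qed simp

text \<open>Finite synthesis is the adjoint of the analysis map and so inherits its bound. Pairing
  the sum \<open>y\<close> with itself and applying Cauchy-Schwarz to the coefficients gives a
  multiple of \<open>norm y\<close>, and one factor \<open>norm y\<close> cancels.\<close>

lemma norm_sum_smul_le:
  assumes "\<And>x. L2_set (\<lambda>j. norm (ip x (g j))) F \<le> b * norm x" "b \<ge> 0"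
  shows "norm (\<Sum>j\<in>F. smul (c j) (g j)) \<le> b * L2_set (\<lambda>j. norm (c j)) F"
proof -
  define y where "y = (\<Sum>j\<in>F. smul (c j) (g j))"
  have "(norm y)\<^sup>2 = norm (ip y y)" by (simp add: ip_self norm_power)
  also have "ip y y = (\<Sum>j\<in>F. conjg (c j) * ip y (g j))"
    by (subst (2) y_def) (simp add: ip_sum_right ip_smul_right)
  also have "norm \<dots> \<le> (\<Sum>j\<in>F. \<bar>norm (c j)\<bar> * \<bar>norm (ip y (g j))\<bar>)"
    by (rule sum_norm_le) (simp add: norm_mult)
  also have "\<dots> \<le> L2_set (\<lambda>j. norm (c j)) F * L2_set (\<lambda>j. norm (ip y (g j))) F"
    by (rule L2_set_mult_ineq)
  also have "\<dots> \<le> L2_set (\<lambda>j. norm (c j)) F * (b * norm y)"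
    by (intro mult_left_mono assms L2_set_nonneg)
  finally have *: "norm y * norm y \<le> (b * L2_set (\<lambda>j. norm (c j)) F) * norm y"
    by (simp add: power2_eq_square mult_ac)
  show ?thesis
  proof (cases "y = 0")
    case True
    then show ?thesis using \<open>b \<ge> 0\<close> by (simp add: y_def L2_set_nonneg)
  next
    case False
    then show ?thesis using * by (simp add: y_def)
  qed
qed

text \<open>The opposite direction of the duality: a bound for synthesis on the unit ball of
  coefficients carries over to analysis.\<close>

lemma L2_set_ip_le:
  assumes "\<And>c. L2_set (\<lambda>j. norm (c j)) F \<le> 1 \<Longrightarrow> norm (\<Sum>j\<in>F. smul (c j) (g j)) \<le> N"
  shows "L2_set (\<lambda>j. norm (ip x (g j))) F \<le> N * norm x"
proof -
  define s where "s = L2_set (\<lambda>j. norm (ip x (g j))) F"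
  have "N \<ge> 0"
    using assms[of "\<lambda>_. 0"] by (simp add: L2_set_def)
  show ?thesis
  proof (cases "s = 0")
    case True
    then show ?thesis using \<open>N \<ge> 0\<close> by (simp add: s_def)
  next
    case False
    then have s: "s > 0" by (simp add: s_def L2_set_nonneg less_le)
    \<comment> \<open>The normalised analysis coefficients of \<open>x\<close> are the extremal unit
      vector: their synthesis has inner product exactly \<open>s\<close> with
      \<open>x\<close>.\<close>
    define c where "c j = of_real (1 / s) * ip x (g j)" for j
    have norm_c: "norm (c j) = (1 / s) * norm (ip x (g j))" for j
      using s by (simp add: c_def norm_mult norm_divide)
    have "L2_set (\<lambda>j. norm (c j)) F = (1 / s) * s"
      unfolding norm_c s_def by (rule L2_set_right_distrib[symmetric]) (use s in \<open>simp add: s_def\<close>)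
    then have le: "norm (\<Sum>j\<in>F. smul (c j) (g j)) \<le> N"
      using s by (intro assms) simp
    have "ip x (\<Sum>j\<in>F. smul (c j) (g j)) = (\<Sum>j\<in>F. of_real ((1 / s) * (norm (ip x (g j)))\<^sup>2))"
      unfolding of_real_mult mult_conjg_of_real[symmetric]
      by (simp only: ip_sum_right ip_smul_right c_def conjg_mult conjg_of_real mult_ac)
    also have "\<dots> = of_real ((1 / s) * (\<Sum>j\<in>F. (norm (ip x (g j)))\<^sup>2))"
      by (simp only: of_real_sum sum_distrib_left)
    also have "(\<Sum>j\<in>F. (norm (ip x (g j)))\<^sup>2) = s\<^sup>2"
      by (simp add: s_def L2_set_def sum_nonneg)
    also have "(1 / s) * s\<^sup>2 = s"
      using s by (simp add: power2_eq_square)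
    finally have "s = norm (ip x (\<Sum>j\<in>F. smul (c j) (g j)))"
      using s by simp
    also have "\<dots> \<le> norm x * N"
      using Cauchy_Schwarz le by (meson mult_left_mono norm_ge_zero order_trans)
    finally show ?thesis by (simp add: s_def mult.commute)
  qed
qed

text \<open>An infinite sum that does not converge is \<open>0\<close>, so the bound needs no proof of convergence.\<close>

lemma norm_synthesis_le:
  assumes bessel: "\<And>F x. finite F \<Longrightarrow> F \<subseteq> J \<Longrightarrow> L2_set (\<lambda>j. norm (ip x (g j))) F \<le> b * norm x"
    and "b \<ge> 0" and c: "c \<in> ell2 J"
  shows "norm (synthesis smul J g c) \<le> b * ell2_norm J c"
proof (cases "(\<lambda>j. smul (c j) (g j)) summable_on J")
  case True
  then have "(sum (\<lambda>j. smul (c j) (g j)) \<longlongrightarrow> synthesis smul J g c) (finite_subsets_at_top J)"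
    using has_sum_infsum by (auto simp: synthesis_def has_sum_def)
  then have "((\<lambda>F. norm (\<Sum>j\<in>F. smul (c j) (g j))) \<longlongrightarrow> norm (synthesis smul J g c))
      (finite_subsets_at_top J)"
    by (rule tendsto_norm)
  moreover have "norm (\<Sum>j\<in>F. smul (c j) (g j)) \<le> b * ell2_norm J c"
    if F: "finite F" "F \<subseteq> J" for F
  proof -
    have "norm (\<Sum>j\<in>F. smul (c j) (g j)) \<le> b * L2_set (\<lambda>j. norm (c j)) F"
      using bessel[OF F] \<open>b \<ge> 0\<close> by (rule norm_sum_smul_le)
    also have "L2_set (\<lambda>j. norm (c j)) F \<le> ell2_norm J c"
      unfolding L2_set_def ell2_norm_def using c F
      by (intro real_sqrt_le_mono finite_sum_le_infsum) (auto simp: ell2_def)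
    finally show ?thesis using \<open>b \<ge> 0\<close> by (simp add: mult_left_mono)
  qed
  ultimately show ?thesis
    by (intro tendsto_upperbound[where F = "finite_subsets_at_top J"])
      (auto intro: eventually_finite_subsets_at_top_weakI)
next
  case False
  then show ?thesis
    using \<open>b \<ge> 0\<close>
    by (simp add: synthesis_def infsum_not_exists ell2_norm_def infsum_nonneg)
qed

section \<open>Comparing two frames through the norm of the difference of their synthesis
  operators\<close>

lemma frame_L2_set_le:
  assumes "frame_with_bounds ip J g A B" "finite F" "F \<subseteq> J"
  shows "L2_set (\<lambda>j. norm (ip x (g j))) F \<le> sqrt B * norm x"
proof -
  have "(\<Sum>j\<in>F. (norm (ip x (g j)))\<^sup>2) \<le> (\<Sum>\<^sub>\<infinity>j\<in>J. (norm (ip x (g j)))\<^sup>2)"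
    using assms by (intro finite_sum_le_infsum) (auto simp: frame_with_bounds_def)
  also have "\<dots> \<le> B * (norm x)\<^sup>2"
    using assms by (auto simp: frame_with_bounds_def)
  finally show ?thesis
    unfolding L2_set_def by (metis norm_ge_zero real_sqrt_le_mono real_sqrt_mult real_sqrt_unique)
qed

text \<open>A real supremum dominates its members only when the set is bounded above. The two upper
  frame bounds supply the crude bound \<open>sqrt B + sqrt B'\<close>.\<close>

lemma norm_synthesis_diff_le_onorm:
  assumes g: "frame_with_bounds ip J g A B" and h: "frame_with_bounds ip J h A' B'"
    and c: "c \<in> ell2 J" "ell2_norm J c \<le> 1"
  shows "norm (synthesis smul J g c - synthesis smul J h c)
    \<le> ell2_onorm J (\<lambda>c. synthesis smul J g c - synthesis smul J h c)"
  unfolding ell2_onorm_def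
proof (rule cSUP_upper)
  have "norm (synthesis smul J g c - synthesis smul J h c) \<le> sqrt B + sqrt B'"
    if c: "c \<in> ell2 J" "ell2_norm J c \<le> 1" for c
  proof -
    have B: "B > 0" "B' > 0" using g h by (auto simp: frame_with_bounds_def)
    have "norm (synthesis smul J g c) \<le> sqrt B * ell2_norm J c"
      using frame_L2_set_le[OF g] B by (intro norm_synthesis_le c) auto
    moreover have "norm (synthesis smul J h c) \<le> sqrt B' * ell2_norm J c"
      using frame_L2_set_le[OF h] B by (intro norm_synthesis_le c) auto
    moreover have "sqrt B * ell2_norm J c \<le> sqrt B" "sqrt B' * ell2_norm J c \<le> sqrt B'"
      using B c by (auto intro: mult_left_le)
    ultimately show ?thesis
      using norm_triangle_ineq4[of "synthesis smul J g c" "synthesis smul J h c"] by linarith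
  qed
  then show "bdd_above ((\<lambda>c. norm (synthesis smul J g c - synthesis smul J h c)) `
      {c \<in> ell2 J. ell2_norm J c \<le> 1})"
    by (intro bdd_aboveI2) auto
qed (use c in auto)

text \<open>The inequality "norm of the adjoint at most norm of the operator", restricted to
  finitely many coordinates so that the finite duality applies.\<close>

lemma L2_set_ip_diff_le_onorm:
  assumes g: "frame_with_bounds ip J g A B" and h: "frame_with_bounds ip J h A' B'"
    and F: "finite F" "F \<subseteq> J"
  shows "L2_set (\<lambda>j. norm (ip x (g j - h j))) F
    \<le> ell2_onorm J (\<lambda>c. synthesis smul J g c - synthesis smul J h c) * norm x"
proof (rule L2_set_ip_le)
  fix c :: "'a \<Rightarrow> 'k"
  assume c: "L2_set (\<lambda>j. norm (c j)) F \<le> 1"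
  \<comment> \<open>Extension by zero keeps the norm of \<open>c\<close> on \<open>F\<close> and
    turns both synthesis series into finite sums, whose difference is the synthesis of
    \<open>g j - h j\<close>.\<close>
  define d where "d j = (if j \<in> F then c j else 0)" for j
  have d: "infsum (\<lambda>j. (norm (d j))\<^sup>2) J = (\<Sum>j\<in>F. (norm (c j))\<^sup>2)"
    "(\<lambda>j. (norm (d j))\<^sup>2) summable_on J"
  proof -
    have "((\<lambda>j. (norm (d j))\<^sup>2) has_sum (\<Sum>j\<in>F. (norm (c j))\<^sup>2)) J"
      using F by (intro has_sum_finite_neutralI) (auto simp: d_def)
    then show "infsum (\<lambda>j. (norm (d j))\<^sup>2) J = (\<Sum>j\<in>F. (norm (c j))\<^sup>2)"
      "(\<lambda>j. (norm (d j))\<^sup>2) summable_on J"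
      by (auto simp: infsumI summable_on_def)
  qed
  have synthesis_d: "synthesis smul J k d = (\<Sum>j\<in>F. smul (c j) (k j))" for k
    unfolding synthesis_def
    using F by (intro infsumI has_sum_finite_neutralI) (auto simp: d_def)
  have "norm (\<Sum>j\<in>F. smul (c j) (g j - h j)) = norm (synthesis smul J g d - synthesis smul J h d)"
    by (simp add: synthesis_d scale_right_diff_distrib sum_subtractf)
  also have "\<dots> \<le> ell2_onorm J (\<lambda>c. synthesis smul J g c - synthesis smul J h c)"
    using g h
  proof (rule norm_synthesis_diff_le_onorm)
    show "d \<in> ell2 J" using d(2) F by (auto simp: ell2_def d_def)
    show "ell2_norm J d \<le> 1" using c by (simp add: ell2_norm_def d(1) L2_set_def)
  qed
  finally show "norm (\<Sum>j\<in>F. smul (c j) (g j - h j))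
    \<le> ell2_onorm J (\<lambda>c. synthesis smul J g c - synthesis smul J h c)" .
qed

text \<open>The loss caused by replacing \<open>h\<close> by \<open>g\<close> on a part
  \<open>X\<close>. The same operator norm over all of \<open>J\<close> serves every
  \<open>X\<close>, which makes the final bounds independent of the partition.\<close>

lemma frame_infsum_le_infsum_plus:
  assumes g: "frame_with_bounds ip J g A B" and h: "frame_with_bounds ip J h A' B'"
    and "X \<subseteq> J"
  shows "(\<Sum>\<^sub>\<infinity>j\<in>X. (norm (ip x (h j)))\<^sup>2) \<le> (\<Sum>\<^sub>\<infinity>j\<in>X. (norm (ip x (g j)))\<^sup>2)
    + ell2_onorm J (\<lambda>c. synthesis smul J g c - synthesis smul J h c)
      * (sqrt B + sqrt B') * (norm x)\<^sup>2"
    (is "_ \<le> _ + ?N * _ * _")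
proof (rule infsum_le_finite_sums)
  show "(\<lambda>j. (norm (ip x (h j)))\<^sup>2) summable_on X"
    using h \<open>X \<subseteq> J\<close> by (auto simp: frame_with_bounds_def intro: summable_on_subset_banach)
  fix F assume F: "finite F" "F \<subseteq> X"
  with \<open>X \<subseteq> J\<close> have FJ: "F \<subseteq> J" by auto
  define p where "p = L2_set (\<lambda>j. norm (ip x (h j))) F"
  define q where "q = L2_set (\<lambda>j. norm (ip x (g j))) F"
  define r where "r = L2_set (\<lambda>j. norm (ip x (g j - h j))) F"
  have nonneg: "p \<ge> 0" "q \<ge> 0" "r \<ge> 0"
    by (simp_all add: p_def q_def r_def L2_set_nonneg)
  have "p \<le> L2_set (\<lambda>j. norm (ip x (g j)) + norm (ip x (g j - h j))) F"
    unfolding p_def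
    by (intro L2_set_mono) (metis ip_diff_right norm_minus_commute norm_triangle_sub, simp)
  also have "\<dots> \<le> q + r"
    unfolding q_def r_def by (rule L2_set_triangle_ineq)
  finally have "p - q \<le> r" by simp
  have "p\<^sup>2 - q\<^sup>2 = (p - q) * (p + q)"
    by (simp add: power2_eq_square algebra_simps)
  \<comment> \<open>The factor \<open>p - q\<close> may be negative; an upper bound on it suffices
    because \<open>p + q\<close> is nonnegative.\<close>
  also have "\<dots> \<le> r * (p + q)"
    using \<open>p - q \<le> r\<close> nonneg by (intro mult_right_mono) auto
  also have "\<dots> \<le> (?N * norm x) * (sqrt B' * norm x + sqrt B * norm x)"
    using nonneg L2_set_ip_diff_le_onorm[OF g h F(1) FJ, of x]
      frame_L2_set_le[OF g F(1) FJ, of x] frame_L2_set_le[OF h F(1) FJ, of x]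
    unfolding p_def[symmetric] q_def[symmetric] r_def[symmetric]
    by (intro mult_mono) auto
  finally have "p\<^sup>2 \<le> q\<^sup>2 + ?N * (sqrt B + sqrt B') * (norm x)\<^sup>2"
    by (simp add: power2_eq_square algebra_simps)
  moreover have "q\<^sup>2 \<le> (\<Sum>\<^sub>\<infinity>j\<in>X. (norm (ip x (g j)))\<^sup>2)"
    using F g \<open>X \<subseteq> J\<close>
    by (auto simp: q_def L2_set_def sum_nonneg frame_with_bounds_def
        intro!: finite_sum_le_infsum intro: summable_on_subset_banach)
  ultimately show "(\<Sum>j\<in>F. (norm (ip x (h j)))\<^sup>2)
    \<le> (\<Sum>\<^sub>\<infinity>j\<in>X. (norm (ip x (g j)))\<^sup>2) + ?N * (sqrt B + sqrt B') * (norm x)\<^sup>2"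
    by (simp add: p_def L2_set_def sum_nonneg)
qed

end

section \<open>Summing over the parts of a partition, and universal bounds\<close>

lemma has_sum_Sigma_finite:
  fixes g :: "'i \<Rightarrow> 'j \<Rightarrow> 'a::{comm_monoid_add, topological_comm_monoid_add}"
  assumes "finite I" "\<And>i. i \<in> I \<Longrightarrow> (g i has_sum s i) (X i)"
  shows "((\<lambda>(i, j). g i j) has_sum (\<Sum>i\<in>I. s i)) (SIGMA i:I. X i)"
proof -
  \<comment> \<open>The index set of pairs is the disjoint union of the fibres over
    \<open>i\<close>, each an injective copy of \<open>X i\<close>.\<close>
  have "((\<lambda>(i, j). g i j) has_sum s i) (Pair i ` X i)" if "i \<in> I" for i
    using assms(2)[OF that] by (subst has_sum_reindex) (auto simp: inj_on_def o_def)
  then have "((\<lambda>(i, j). g i j) has_sum (\<Sum>i\<in>I. s i)) (\<Union>i\<in>I. Pair i ` X i)"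
    by (intro sum_has_sum assms) auto
  moreover have "(\<Union>i\<in>I. Pair i ` X i) = (SIGMA i:I. X i)" by auto
  ultimately show ?thesis by simp
qed

theorem theorem2p8:
  fixes smul :: "'k::real_or_complex \<Rightarrow> 'h::banach \<Rightarrow> 'h"
    and ip :: "'h \<Rightarrow> 'h \<Rightarrow> 'k"
    and J :: "'j set"
    and m :: nat
    and f :: "nat \<Rightarrow> 'j \<Rightarrow> 'h"
    and A B :: "nat \<Rightarrow> real"
  assumes "separable_hilbert_space smul ip"
    and "countable J"
    and "m \<ge> 2"
    and "\<And>i. i \<in> {1..m} \<Longrightarrow> frame_with_bounds ip J (f i) (A i) (B i)"
    and "\<And>k i. k \<in> {1..m} \<Longrightarrow> i \<in> {1..m} \<Longrightarrow>
      ell2_onorm J (\<lambda>c. synthesis smul J (f i) c - synthesis smul J (f k) c)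
        < A k / ((real m - 1) * (sqrt (B i) + sqrt (B k)))"
  shows "woven ip {1..m} J f"
proof -
  interpret separable_hilbert_space smul ip by fact
  define S where "S i X x = (\<Sum>\<^sub>\<infinity>j\<in>X. (norm (ip x (f i j)))\<^sup>2)" for i X x
  define N where "N i = ell2_onorm J (\<lambda>c. synthesis smul J (f i) c - synthesis smul J (f 1) c)" for i
  \<comment> \<open>The loss on part \<open>i\<close>. It is set to 0 at \<open>i = 1\<close>, where
    nothing is replaced, so that only \<open>m - 1\<close> parts are charged.\<close>
  define K where "K i = (if i = 1 then 0 else N i * (sqrt (B i) + sqrt (B 1)))" for i
  have one: "1 \<in> {1..m}" using \<open>m \<ge> 2\<close> by auto
  note frame = assms(4)
  have pos: "A i > 0" "B i > 0" if "i \<in> {1..m}" for i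
    using frame[OF that] by (auto simp: frame_with_bounds_def)
  have S_sum: "((\<lambda>j. (norm (ip x (f i j)))\<^sup>2) has_sum S i X x) X" if "i \<in> {1..m}" "X \<subseteq> J" for i X x
    using frame[OF that(1)] that(2) unfolding S_def
    by (intro has_sum_infsum) (auto simp: frame_with_bounds_def intro: summable_on_subset_banach)
  have S_le: "S i X x \<le> B i * (norm x)\<^sup>2" if "i \<in> {1..m}" "X \<subseteq> J" for i X x
  proof -
    have "S i X x \<le> S i J x"
      using S_sum[OF that] S_sum[OF that(1) order.refl] that(2) by (rule has_sum_mono2) auto
    also have "\<dots> \<le> B i * (norm x)\<^sup>2"
      using frame[OF that(1)] by (auto simp: frame_with_bounds_def S_def)
    finally show ?thesis .
  qed
  have S_1_le: "S 1 X x \<le> S i X x + K i * (norm x)\<^sup>2" if "i \<in> {1..m}" "X \<subseteq> J" for i X x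
    using frame_infsum_le_infsum_plus[OF frame[OF that(1)] frame[OF one] that(2), of x]
    by (auto simp: K_def N_def S_def)
  \<comment> \<open>The hypothesis with \<open>k = 1\<close> is exactly what keeps each loss below
    an equal share of \<open>A 1\<close> among the \<open>m - 1\<close> other parts.\<close>
  have K_less: "K i < A 1 / (real m - 1)" if "i \<in> {1..m} - {1}" for i
  proof -
    have "sqrt (B i) + sqrt (B 1) > 0"
      using pos[of i] pos[of 1] one that by (simp add: add_pos_pos)
    moreover have "N i < A 1 / ((real m - 1) * (sqrt (B i) + sqrt (B 1)))"
      unfolding N_def using one that by (intro assms(5)) auto
    moreover have "real m - 1 > 0" using \<open>m \<ge> 2\<close> by simp
    ultimately show ?thesis
      using that by (simp add: K_def pos_less_divide_eq mult_ac)
  qed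
  have "(\<Sum>i\<in>{1..m}. K i) = (\<Sum>i\<in>{1..m} - {1}. K i)"
    by (rule sum.mono_neutral_right) (auto simp: K_def)
  also have "\<dots> < (\<Sum>i\<in>{1..m} - {1}. A 1 / (real m - 1))"
    proof (rule sum_strict_mono)
    \<comment> \<open>Strictness survives summation only over a nonempty index set;
      \<open>m \<ge> 2\<close> provides the index 2.\<close>
    have "2 \<in> {1..m} - {1}" using \<open>m \<ge> 2\<close> by simp
    then show "{1..m} - {1} \<noteq> {}" by blast
  qed (use K_less in auto)
  also have "\<dots> = A 1"
    using \<open>m \<ge> 2\<close> by (simp add: of_nat_diff)
  finally have lower_pos: "A 1 - (\<Sum>i\<in>{1..m}. K i) > 0" by simp
  have upper_pos: "(\<Sum>i\<in>{1..m}. B i) > 0"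
    using one pos by (intro sum_pos) auto
  \<comment> \<open>Neither bound mentions \<open>\<sigma>\<close>, so both are universal. The upper
    one holds since each part contributes at most its full frame sum over \<open>J\<close>.\<close>
  have "frame_with_bounds ip (SIGMA i:{1..m}. \<sigma> i) (\<lambda>(i, j). f i j)
      (A 1 - (\<Sum>i\<in>{1..m}. K i)) (\<Sum>i\<in>{1..m}. B i)"
    if \<sigma>: "indexed_partition {1..m} J \<sigma>" for \<sigma>
    unfolding frame_with_bounds_def
  proof (intro conjI allI lower_pos upper_pos)
    fix x
    have sub: "\<sigma> i \<subseteq> J" if "i \<in> {1..m}" for i
      using \<sigma> that by (auto simp: indexed_partition_def)
    have total: "((\<lambda>p. (norm (ip x (case p of (i, j) \<Rightarrow> f i j)))\<^sup>2) has_sum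
        (\<Sum>i\<in>{1..m}. S i (\<sigma> i) x)) (SIGMA i:{1..m}. \<sigma> i)"
      using has_sum_Sigma_finite[OF _ S_sum[OF _ sub], where I = "{1..m}"]
      by (simp add: case_prod_unfold)
    then show "(\<lambda>p. (norm (ip x (case p of (i, j) \<Rightarrow> f i j)))\<^sup>2) summable_on
        (SIGMA i:{1..m}. \<sigma> i)"
      by (auto simp: summable_on_def)
    have "A 1 * (norm x)\<^sup>2 \<le> S 1 J x"
      using frame[OF one] by (auto simp: frame_with_bounds_def S_def)
    \<comment> \<open>The frame sum of \<open>f 1\<close> splits along the disjoint parts covering
      \<open>J\<close>; afterwards \<open>f 1\<close> is exchanged for \<open>f i\<close> on each
      part at cost \<open>K i\<close>.\<close>
    also have "S 1 J x = (\<Sum>i\<in>{1..m}. S 1 (\<sigma> i) x)"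
    proof -
      have "((\<lambda>j. (norm (ip x (f 1 j)))\<^sup>2) has_sum (\<Sum>i\<in>{1..m}. S 1 (\<sigma> i) x)) (\<Union>i\<in>{1..m}. \<sigma> i)"
        using \<sigma> by (intro sum_has_sum S_sum one sub)
          (auto simp: indexed_partition_def disjoint_family_on_def)
      then show ?thesis
        using \<sigma> by (simp add: S_def indexed_partition_def infsumI)
    qed
    also have "\<dots> \<le> (\<Sum>i\<in>{1..m}. S i (\<sigma> i) x + K i * (norm x)\<^sup>2)"
      by (intro sum_mono S_1_le sub)
    finally show "(A 1 - (\<Sum>i\<in>{1..m}. K i)) * (norm x)\<^sup>2
        \<le> (\<Sum>\<^sub>\<infinity>p\<in>(SIGMA i:{1..m}. \<sigma> i). (norm (ip x (case p of (i, j) \<Rightarrow> f i j)))\<^sup>2)"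
      unfolding infsumI[OF total]
      by (simp add: sum.distrib sum_distrib_right left_diff_distrib)
    show "(\<Sum>\<^sub>\<infinity>p\<in>(SIGMA i:{1..m}. \<sigma> i). (norm (ip x (case p of (i, j) \<Rightarrow> f i j)))\<^sup>2)
        \<le> (\<Sum>i\<in>{1..m}. B i) * (norm x)\<^sup>2"
      unfolding infsumI[OF total] sum_distrib_right by (intro sum_mono S_le sub)
  qed
  with lower_pos upper_pos show ?thesis
    unfolding woven_def by blast
qed

end
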